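(* Assume that $\mathbb{S}(I)$ contains the identity map $\mathrm{id}_I$, and let $f,g\in T_{\mathbb{S}(I)}(X,\mathcal{P})$. Then $(f,g)\in \mathcal{J}$ in $T_{\mathbb{S}(I)}(X,\mathcal{P})$ if and only if there exist $\alpha,\beta,\gamma,\delta\in \mathbb{S}(I)$ and mappings $\varphi\colon Xg\to X$, $\psi\colon Xf\to X$ such that: (i) $X_if\subseteq (X_{i\alpha}g)\varphi$ and $X_ig\subseteq (X_{i\gamma}f)\psi$ for all $i\in I$; and (ii) $(X_i\cap Xg)\varphi\subseteq X_{i\beta}$ for all $i\in I\chi^{(g)}$, and $(X_j\cap Xf)\psi\subseteq X_{j\delta}$ for all $j\in I\chi^{(f)}$.
   Context: $X$ is a nonempty set (possibly infinite) and $\mathcal{P}=\{X_i : i\in I\}$ is a partition of $X$ into nonempty blocks, with $X_i\cap X_j=\varnothing$ for $i\neq j$. $T(Z)$ denotes the semigroup of all maps $Z\to Z$ under composition. Maps are written on the right and composed from left to right: $x(fg)=(xf)g$; $Af=\{af: a\in A\}$. $T(X,\mathcal{P})$ is the subsemigroup of all $f\in T(X)$ such that for every $i\in I$ there is $j\in I$ with $X_if\subseteq X_j$. For $f\in T(X,\mathcal{P})$ the character $\chi^{(f)}\in T(I)$ is defined by $i\chi^{(f)}=j$ whenever $X_if\subseteq X_j$. For a subsemigroup $\mathbb{S}(I)$ of $T(I)$, $T_{\mathbb{S}(I)}(X,\mathcal{P})=\{f\in T(X,\mathcal{P}): \chi^{(f)}\in \mathbb{S}(I)\}$, a subsemigroup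 of $T(X,\mathcal{P})$; it contains $\mathrm{id}_X$ iff $\mathrm{id}_I\in\mathbb{S}(I)$. In a semigroup $S$ with identity, Green's relation $\mathcal{J}$ is: $(a,b)\in\mathcal{J}$ iff $SaS=SbS$. *)

theory Defs
  imports "HOL-Algebra.Coset" "HOL-Library.FuncSet" "HOL-Library.Disjoint_Sets"
begin

text \<open>Maps \<open>Z \<rightarrow> Z\<close> are represented by functions that are \<open>undefined\<close> outside \<open>Z\<close>, so that
  equality of maps is equality on \<open>Z\<close>. Products are composed from left to right:
  \<open>x (f \<otimes> g) = (x f) g\<close>, hence the swapped arguments of \<open>compose\<close>.\<close>

definition full_trans :: "'a set \<Rightarrow> ('a \<Rightarrow> 'a) monoid" where
  "full_trans Z =
     \<lparr>carrier = Z \<rightarrow>\<^sub>E Z, mult = (\<lambda>f g. compose Z g f), one = (\<lambda>x\<in>Z. x)\<rparr>"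

definition subsemigroup :: "'m set \<Rightarrow> ('m, 'b) monoid_scheme \<Rightarrow> bool" where
  "subsemigroup H M \<longleftrightarrow>
     H \<noteq> {} \<and> H \<subseteq> carrier M \<and> (\<forall>a\<in>H. \<forall>b\<in>H. a \<otimes>\<^bsub>M\<^esub> b \<in> H)"

text \<open>The formula \<open>SaS = SbS\<close> describes Green's relation \<open>J\<close> only when \<open>M\<close> has an identity;
  see \<open>monoid_char_trans\<close> below.\<close>

definition green_J :: "('m, 'b) monoid_scheme \<Rightarrow> ('m \<times> 'm) set" where
  "green_J M = {(a, b). a \<in> carrier M \<and> b \<in> carrier M \<and>
     carrier M <#>\<^bsub>M\<^esub> {a} <#>\<^bsub>M\<^esub> carrier M = carrier M <#>\<^bsub>M\<^esub> {b} <#>\<^bsub>M\<^esub> carrier M}"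

definition indexed_partition :: "'a set \<Rightarrow> 'i set \<Rightarrow> ('i \<Rightarrow> 'a set) \<Rightarrow> bool" where
  "indexed_partition X I P \<longleftrightarrow>
     (\<Union>i\<in>I. P i) = X \<and> (\<forall>i\<in>I. P i \<noteq> {}) \<and> disjoint_family_on P I"

definition part_trans :: "'a set \<Rightarrow> 'i set \<Rightarrow> ('i \<Rightarrow> 'a set) \<Rightarrow> ('a \<Rightarrow> 'a) set" where
  "part_trans X I P =
     {f \<in> carrier (full_trans X). \<forall>i\<in>I. \<exists>j\<in>I. f ` P i \<subseteq> P j}"

text \<open>The index \<open>j\<close> below is unique when \<open>f \<in> part_trans X I P\<close>, because the blocks are
  nonempty and pairwise disjoint.\<close>

definition character :: "'i set \<Rightarrow> ('i \<Rightarrow> 'a set) \<Rightarrow> ('a \<Rightarrow> 'a) \<Rightarrow> 'i \<Rightarrow> 'i" where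
  "character I P f = (\<lambda>i\<in>I. THE j. j \<in> I \<and> f ` P i \<subseteq> P j)"

definition char_trans ::
    "'a set \<Rightarrow> 'i set \<Rightarrow> ('i \<Rightarrow> 'a set) \<Rightarrow> ('i \<Rightarrow> 'i) set \<Rightarrow> ('a \<Rightarrow> 'a) monoid" where
  "char_trans X I P S =
     (full_trans X)\<lparr>carrier := {f \<in> part_trans X I P. character I P f \<in> S}\<rparr>"

lemma monoid_full_trans: "monoid (full_trans Z)"
proof (rule monoidI)
  fix f g h
  assume "f \<in> carrier (full_trans Z)" "g \<in> carrier (full_trans Z)" "h \<in> carrier (full_trans Z)"
  then show "f \<otimes>\<^bsub>full_trans Z\<^esub> g \<otimes>\<^bsub>full_trans Z\<^esub> h =
      f \<otimes>\<^bsub>full_trans Z\<^esub> (g \<otimes>\<^bsub>full_trans Z\<^esub> h)"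
    by (simp add: full_trans_def PiE_def compose_assoc)
qed (auto simp: full_trans_def PiE_def compose_Id Id_compose intro: funcset_compose[THEN funcset_mem])

lemma character_eqI:
  assumes "indexed_partition X I P" "i \<in> I" "j \<in> I" "f ` P i \<subseteq> P j"
  shows "character I P f i = j"
proof -
  have ne: "P i \<noteq> {}" and disj: "disjoint_family_on P I"
    using assms by (auto simp: indexed_partition_def)
  have "(THE k. k \<in> I \<and> f ` P i \<subseteq> P k) = j"
  proof (rule the_equality)
    fix k assume k: "k \<in> I \<and> f ` P i \<subseteq> P k"
    obtain x where "x \<in> P i" using ne by blast
    then have "f x \<in> P k \<inter> P j" using k assms(4) by blast
    then show "k = j"
      using disj k assms(3) by (auto simp: disjoint_family_on_def)
  qed (use assms in auto)
  then show ?thesis using assms(2) by (simp add: character_def)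
qed

lemma character_works:
  assumes "indexed_partition X I P" "f \<in> part_trans X I P" "i \<in> I"
  shows "character I P f i \<in> I" "f ` P i \<subseteq> P (character I P f i)"
proof -
  obtain j where j: "j \<in> I" "f ` P i \<subseteq> P j"
    using assms by (auto simp: part_trans_def)
  moreover have "character I P f i = j"
    using character_eqI[OF assms(1,3) j] .
  ultimately show "character I P f i \<in> I" "f ` P i \<subseteq> P (character I P f i)"
    by auto
qed

lemma character_mult:
  assumes p: "indexed_partition X I P" and f: "f \<in> part_trans X I P" and g: "g \<in> part_trans X I P"
  shows "f \<otimes>\<^bsub>full_trans X\<^esub> g \<in> part_trans X I P"
    and "character I P (f \<otimes>\<^bsub>full_trans X\<^esub> g) =
      character I P f \<otimes>\<^bsub>full_trans I\<^esub> character I P g"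
proof -
  let ?h = "f \<otimes>\<^bsub>full_trans X\<^esub> g"
  let ?c = "character I P"
  have h: "?h ` P i \<subseteq> P (?c g (?c f i))" and hI: "?c g (?c f i) \<in> I" if "i \<in> I" for i
  proof -
    have "P i \<subseteq> X" using p that by (auto simp: indexed_partition_def)
    then have "?h ` P i = g ` f ` P i"
      by (auto simp: full_trans_def compose_def image_iff)
    also have "\<dots> \<subseteq> g ` P (?c f i)"
      using character_works[OF p f that] by blast
    also have "\<dots> \<subseteq> P (?c g (?c f i))"
      using character_works[OF p g] character_works[OF p f that] by blast
    finally show "?h ` P i \<subseteq> P (?c g (?c f i))" .
    show "?c g (?c f i) \<in> I"
      using character_works[OF p g] character_works[OF p f that] by blast
  qed
  have "?h \<in> carrier (full_trans X)"
    using f g monoid.m_closed[OF monoid_full_trans] by (auto simp: part_trans_def)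
  moreover have "\<forall>i\<in>I. \<exists>j\<in>I. ?h ` P i \<subseteq> P j"
    using h hI by blast
  ultimately show "?h \<in> part_trans X I P"
    unfolding part_trans_def by blast
  show "?c ?h = ?c f \<otimes>\<^bsub>full_trans I\<^esub> ?c g"
  proof
    fix i show "?c ?h i = (?c f \<otimes>\<^bsub>full_trans I\<^esub> ?c g) i"
    proof (cases "i \<in> I")
      case True
      then have "(?c f \<otimes>\<^bsub>full_trans I\<^esub> ?c g) i = ?c g (?c f i)"
        by (simp add: full_trans_def compose_def)
      then show ?thesis
        by (simp only: character_eqI[OF p True hI[OF True] h[OF True]])
    qed (simp add: full_trans_def compose_def character_def)
  qed
qed

lemma character_one:
  assumes p: "indexed_partition X I P"
  shows "\<one>\<^bsub>full_trans X\<^esub> \<in> part_trans X I P"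
    and "character I P \<one>\<^bsub>full_trans X\<^esub> = \<one>\<^bsub>full_trans I\<^esub>"
proof -
  let ?e = "\<one>\<^bsub>full_trans X\<^esub>"
  have e: "?e ` P i \<subseteq> P i" if "i \<in> I" for i
    using p that by (auto simp: indexed_partition_def full_trans_def)
  have "?e \<in> carrier (full_trans X)"
    by (rule monoid.one_closed[OF monoid_full_trans])
  then show "?e \<in> part_trans X I P"
    using e by (auto simp: part_trans_def)
  show "character I P ?e = \<one>\<^bsub>full_trans I\<^esub>"
  proof
    fix i show "character I P ?e i = \<one>\<^bsub>full_trans I\<^esub> i"
    proof (cases "i \<in> I")
      case True
      then have "\<one>\<^bsub>full_trans I\<^esub> i = i"
        by (simp add: full_trans_def)
      then show ?thesis
        by (simp only: character_eqI[OF p True True e[OF True]])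
    qed (simp add: full_trans_def character_def)
  qed
qed

lemma monoid_char_trans:
  assumes p: "indexed_partition X I P" and S: "subsemigroup S (full_trans I)"
    and one: "\<one>\<^bsub>full_trans I\<^esub> \<in> S"
  shows "monoid (char_trans X I P S)"
proof -
  interpret T: monoid "full_trans X" by (rule monoid_full_trans)
  have sub: "carrier (char_trans X I P S) \<subseteq> carrier (full_trans X)"
    by (auto simp: char_trans_def part_trans_def)
  have mult: "mult (char_trans X I P S) = mult (full_trans X)"
    and one': "one (char_trans X I P S) = one (full_trans X)"
    by (simp_all add: char_trans_def)
  show ?thesis
  proof (rule monoidI, unfold mult one')
    fix a b
    assume "a \<in> carrier (char_trans X I P S)" "b \<in> carrier (char_trans X I P S)"
    then show "a \<otimes>\<^bsub>full_trans X\<^esub> b \<in> carrier (char_trans X I P S)"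
      using S character_mult[OF p, of a b] by (simp add: char_trans_def subsemigroup_def)
  next
    show "\<one>\<^bsub>full_trans X\<^esub> \<in> carrier (char_trans X I P S)"
      using one character_one[OF p] by (simp add: char_trans_def)
  qed (use sub in \<open>simp_all add: T.m_assoc subset_iff\<close>)
qed

end

theory Submission
  imports Defs
begin

text \<open>In a monoid \<open>M\<close>, the sets \<open>MaM\<close> and \<open>MbM\<close> agree iff each of \<open>a\<close>, \<open>b\<close> lies in the
  principal ideal generated by the other (\<open>green_J_iff_mutual_ideals\<close>). The whole question is
  therefore when \<open>f = pgq\<close> is solvable with \<open>p\<close> and \<open>q\<close> in \<open>char_trans X I P S\<close>, and this is what
  \<open>principal_ideal_iff\<close> answers; applying it to \<open>(f, g)\<close> and to \<open>(g, f)\<close> gives the two halves of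
  the conditions.

  From a factorization \<open>f = pgq\<close>, the characters of \<open>p\<close> and \<open>q\<close> serve as \<open>\<alpha>\<close> and \<open>\<beta>\<close>, and the
  restriction of \<open>q\<close> to \<open>Xg\<close> serves as \<open>\<phi>\<close>. Conversely, \<open>\<alpha>\<close> and \<open>\<beta>\<close> prescribe the blocks into
  which \<open>p\<close> and \<open>q\<close> must map, and \<open>\<phi>\<close> prescribes \<open>q\<close> on \<open>Xg\<close>. A point \<open>x\<close> of \<open>X\<^sub>i\<close> is sent by \<open>p\<close>
  to a point of \<open>X\<^bsub>i\<alpha>\<^esub>\<close> that \<open>g\<phi>\<close> maps to \<open>xf\<close>, and \<open>q\<close> extends \<open>\<phi>\<close> by arbitrary values in the
  prescribed blocks. Condition (ii) speaks only of the blocks with index in \<open>I\<chi>\<^sup>(\<^sup>g\<^sup>)\<close>, but every point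
  of \<open>Xg\<close> lies in one of these.\<close>

lemma (in monoid) mem_two_sided_ideal:
  "x \<in> carrier G <#> {b} <#> carrier G \<longleftrightarrow>
     (\<exists>p\<in>carrier G. \<exists>q\<in>carrier G. x = p \<otimes> b \<otimes> q)"
  by (auto simp: set_mult_def)

text \<open>The ideal \<open>MbM\<close> absorbs multiplication on both sides, so it contains \<open>MaM\<close> as soon as it
  contains \<open>a\<close>; the identity gives \<open>a \<in> MaM\<close>, hence the converse.\<close>

lemma (in monoid) two_sided_ideal_subset_iff:
  assumes a: "a \<in> carrier G" and b: "b \<in> carrier G"
  shows "carrier G <#> {a} <#> carrier G \<subseteq> carrier G <#> {b} <#> carrier G \<longleftrightarrow>
     a \<in> carrier G <#> {b} <#> carrier G"
proof
  have "a = \<one> \<otimes> a \<otimes> \<one>" using a by simp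
  then have "a \<in> carrier G <#> {a} <#> carrier G"
    unfolding mem_two_sided_ideal by blast
  then show "a \<in> carrier G <#> {b} <#> carrier G"
    if "carrier G <#> {a} <#> carrier G \<subseteq> carrier G <#> {b} <#> carrier G"
    using that by blast
next
  assume "a \<in> carrier G <#> {b} <#> carrier G"
  then obtain p q where pq: "p \<in> carrier G" "q \<in> carrier G" "a = p \<otimes> b \<otimes> q"
    unfolding mem_two_sided_ideal by blast
  show "carrier G <#> {a} <#> carrier G \<subseteq> carrier G <#> {b} <#> carrier G"
  proof
    fix x assume "x \<in> carrier G <#> {a} <#> carrier G"
    then obtain r s where rs: "r \<in> carrier G" "s \<in> carrier G" "x = r \<otimes> a \<otimes> s"
      unfolding mem_two_sided_ideal by blast
    have "x = (r \<otimes> p) \<otimes> b \<otimes> (q \<otimes> s)"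
      using pq rs b by (simp add: m_assoc)
    then show "x \<in> carrier G <#> {b} <#> carrier G"
      unfolding mem_two_sided_ideal using pq rs by blast
  qed
qed

lemma (in monoid) green_J_iff_mutual_ideals:
  assumes "a \<in> carrier G" "b \<in> carrier G"
  shows "(a, b) \<in> green_J G \<longleftrightarrow>
     a \<in> carrier G <#> {b} <#> carrier G \<and> b \<in> carrier G <#> {a} <#> carrier G"
  unfolding two_sided_ideal_subset_iff[OF assms, symmetric]
    two_sided_ideal_subset_iff[OF assms(2,1), symmetric]
  using assms by (auto simp: green_J_def)

lemma block_subset:
  assumes "indexed_partition X I P" "i \<in> I"
  shows "P i \<subseteq> X"
  using assms by (auto simp: indexed_partition_def)

lemma mem_block:
  assumes "indexed_partition X I P" "x \<in> X"
  obtains i where "i \<in> I" "x \<in> P i"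
  using assms by (auto simp: indexed_partition_def)

lemma block_unique:
  assumes "indexed_partition X I P" "i \<in> I" "j \<in> I" "x \<in> P i" "x \<in> P j"
  shows "i = j"
  using assms by (auto simp: indexed_partition_def disjoint_family_on_def)

text \<open>Membership in \<open>char_trans X I P S\<close> is used through a prescribed character: it suffices to
  exhibit an element of \<open>S\<close> that says in which block the map sends each block.\<close>

lemma char_trans_memI:
  assumes p: "indexed_partition X I P" and S: "subsemigroup S (full_trans I)"
    and \<alpha>: "\<alpha> \<in> S" and ext: "h \<in> extensional X"
    and blocks: "\<And>i x. i \<in> I \<Longrightarrow> x \<in> P i \<Longrightarrow> h x \<in> P (\<alpha> i)"
  shows "h \<in> carrier (char_trans X I P S)"
proof -
  have \<alpha>I: "\<alpha> \<in> I \<rightarrow>\<^sub>E I" using S \<alpha> by (auto simp: subsemigroup_def full_trans_def)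
  have hX: "h x \<in> X" if x: "x \<in> X" for x
  proof -
    obtain i where i: "i \<in> I" "x \<in> P i" using mem_block[OF p x] .
    then show ?thesis using blocks[OF i] block_subset[OF p, of "\<alpha> i"] \<alpha>I by auto
  qed
  have part: "h \<in> part_trans X I P"
    unfolding part_trans_def full_trans_def
  proof (simp add: PiE_def ext, intro conjI ballI)
    show "h \<in> X \<rightarrow> X" using hX by blast
    fix i assume i: "i \<in> I"
    have "h ` P i \<subseteq> P (\<alpha> i)" using blocks[OF i] by blast
    moreover have "\<alpha> i \<in> I" using \<alpha>I i by blast
    ultimately show "\<exists>j\<in>I. h ` P i \<subseteq> P j" by blast
  qed
  have "character I P h = \<alpha>"
  proof
    fix i show "character I P h i = \<alpha> i"
    proof (cases "i \<in> I")
      case True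
      then show ?thesis using \<alpha>I blocks by (intro character_eqI[OF p]) auto
    next
      case False
      then show ?thesis using \<alpha>I by (auto simp: character_def)
    qed
  qed
  with part \<alpha> show ?thesis by (simp add: char_trans_def)
qed

lemma char_trans_memD:
  assumes p: "indexed_partition X I P" and h: "h \<in> carrier (char_trans X I P S)"
  shows "character I P h \<in> S" "h \<in> X \<rightarrow>\<^sub>E X"
    and "i \<in> I \<Longrightarrow> character I P h i \<in> I"
    and "i \<in> I \<Longrightarrow> h ` P i \<subseteq> P (character I P h i)"
proof -
  have part: "h \<in> part_trans X I P" using h by (simp add: char_trans_def)
  show "character I P h \<in> S" "h \<in> X \<rightarrow>\<^sub>E X"
    using h by (auto simp: char_trans_def part_trans_def full_trans_def)
  show "i \<in> I \<Longrightarrow> character I P h i \<in> I"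
    and "i \<in> I \<Longrightarrow> h ` P i \<subseteq> P (character I P h i)"
    using character_works[OF p part] by auto
qed

lemma char_trans_mult_apply:
  assumes "a \<in> X \<rightarrow>\<^sub>E X" "x \<in> X"
  shows "(a \<otimes>\<^bsub>char_trans X I P S\<^esub> b \<otimes>\<^bsub>char_trans X I P S\<^esub> c) x = c (b (a x))"
  using assms by (auto simp: char_trans_def full_trans_def compose_def)

text \<open>The product \<open>pgq\<close> depends on \<open>q\<close> only through its restriction \<open>\<phi>\<close> to \<open>Xg\<close>, and membership of
  \<open>p\<close> and \<open>q\<close> in the semigroup only on the blocks into which they map. So \<open>\<alpha>\<close>, \<open>\<beta>\<close> and \<open>\<phi>\<close> are all
  that is needed to rebuild a factorization \<open>f = pgq\<close>.\<close>

lemma principal_ideal_iff: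
  assumes p: "indexed_partition X I P" and S: "subsemigroup S (full_trans I)"
    and one: "\<one>\<^bsub>full_trans I\<^esub> \<in> S"
    and f: "f \<in> carrier (char_trans X I P S)"
    and g: "g \<in> carrier (char_trans X I P S)"
  shows "f \<in> carrier (char_trans X I P S) <#>\<^bsub>char_trans X I P S\<^esub> {g}
        <#>\<^bsub>char_trans X I P S\<^esub> carrier (char_trans X I P S) \<longleftrightarrow>
    (\<exists>\<alpha>\<in>S. \<exists>\<beta>\<in>S. \<exists>\<phi> \<in> g ` X \<rightarrow>\<^sub>E X.
      (\<forall>i\<in>I. f ` P i \<subseteq> \<phi> ` (g ` P (\<alpha> i))) \<and>
      (\<forall>i \<in> character I P g ` I. \<phi> ` (P i \<inter> g ` X) \<subseteq> P (\<beta> i)))"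
    (is "?ideal \<longleftrightarrow> ?conditions")
proof -
  let ?M = "char_trans X I P S"
  interpret M: monoid ?M by (rule monoid_char_trans[OF p S one])
  note fX = char_trans_memD(2)[OF p f] and gX = char_trans_memD(2)[OF p g]
  show ?thesis
  proof
    assume ?ideal
    then obtain u q where u: "u \<in> carrier ?M" and q: "q \<in> carrier ?M"
      and fuq: "f = u \<otimes>\<^bsub>?M\<^esub> g \<otimes>\<^bsub>?M\<^esub> q"
      unfolding M.mem_two_sided_ideal by blast
    note uD = char_trans_memD[OF p u] and qD = char_trans_memD[OF p q]
    let ?\<phi> = "restrict q (g ` X)"
    have "?\<phi> \<in> g ` X \<rightarrow>\<^sub>E X" using gX qD(2) by auto
    moreover have "f ` P i \<subseteq> ?\<phi> ` (g ` P (character I P u i))" if i: "i \<in> I" for i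
    proof
      fix y assume "y \<in> f ` P i"
      then obtain x where x: "x \<in> P i" "y = f x" by blast
      have xX: "x \<in> X" using block_subset[OF p i] x by blast
      have uX: "u x \<in> X" using uD(2) xX by blast
      have "y = ?\<phi> (g (u x))"
        unfolding x fuq char_trans_mult_apply[OF uD(2) xX] using uX by simp
      moreover have "u x \<in> P (character I P u i)" using uD(4)[OF i] x by blast
      ultimately show "y \<in> ?\<phi> ` (g ` P (character I P u i))" by blast
    qed
    moreover have "?\<phi> ` (P i \<inter> g ` X) \<subseteq> P (character I P q i)"
      if "i \<in> character I P g ` I" for i
    proof -
      have "i \<in> I" using that char_trans_memD(3)[OF p g] by blast
      then show ?thesis using qD(4)[of i] by auto
    qed
    ultimately show ?conditions using uD(1) qD(1) by blast
  next
    assume ?conditions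
    then obtain \<alpha> \<beta> \<phi> where \<alpha>: "\<alpha> \<in> S" and \<beta>: "\<beta> \<in> S" and \<phi>: "\<phi> \<in> g ` X \<rightarrow>\<^sub>E X"
      and cover: "\<forall>i\<in>I. f ` P i \<subseteq> \<phi> ` (g ` P (\<alpha> i))"
      and blocks: "\<forall>i \<in> character I P g ` I. \<phi> ` (P i \<inter> g ` X) \<subseteq> P (\<beta> i)"
      by (elim bexE conjE) (rule that)
    have \<alpha>I: "\<alpha> i \<in> I" and \<beta>I: "\<beta> i \<in> I" if "i \<in> I" for i
      using S \<alpha> \<beta> that by (auto simp: subsemigroup_def full_trans_def)
    have "\<forall>x\<in>X. \<exists>y. \<forall>i\<in>I. x \<in> P i \<longrightarrow> y \<in> P (\<alpha> i) \<and> \<phi> (g y) = f x"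
    proof
      fix x assume x: "x \<in> X"
      obtain i where i: "i \<in> I" "x \<in> P i" using mem_block[OF p x] .
      obtain y where "y \<in> P (\<alpha> i)" "\<phi> (g y) = f x" using bspec[OF cover i(1)] i(2) by force
      then show "\<exists>y. \<forall>i\<in>I. x \<in> P i \<longrightarrow> y \<in> P (\<alpha> i) \<and> \<phi> (g y) = f x"
        using block_unique[OF p i(1) _ i(2)] by blast
    qed
    from bchoice[OF this] obtain u where
      "\<forall>x\<in>X. \<forall>i\<in>I. x \<in> P i \<longrightarrow> u x \<in> P (\<alpha> i) \<and> \<phi> (g (u x)) = f x" ..
    then have u: "u x \<in> P (\<alpha> i) \<and> \<phi> (g (u x)) = f x" if "x \<in> X" "i \<in> I" "x \<in> P i" for x i
      using that by simp
    have "\<forall>x\<in>X. \<exists>y. (x \<in> g ` X \<longrightarrow> y = \<phi> x) \<and> (\<forall>i\<in>I. x \<in> P i \<longrightarrow> y \<in> P (\<beta> i))"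
    proof
      fix x assume x: "x \<in> X"
      obtain i where i: "i \<in> I" "x \<in> P i" using mem_block[OF p x] .
      have "\<exists>y. (x \<in> g ` X \<longrightarrow> y = \<phi> x) \<and> y \<in> P (\<beta> i)"
      proof (cases "x \<in> g ` X")
        case True
        \<comment> \<open>A block that meets \<open>Xg\<close> has its index in the image of the character of \<open>g\<close>.\<close>
        then obtain z where z: "z \<in> X" "x = g z" by blast
        obtain k where k: "k \<in> I" "z \<in> P k" using mem_block[OF p z(1)] .
        have "x \<in> P (character I P g k)" using char_trans_memD(4)[OF p g k(1)] k z by blast
        then have "i = character I P g k"
          using block_unique[OF p i(1) char_trans_memD(3)[OF p g k(1)] i(2)] by blast
        then have "\<phi> x \<in> P (\<beta> i)" using bspec[OF blocks, of i] k i True by blast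
        then show ?thesis by blast
      next
        case False
        have "P (\<beta> i) \<noteq> {}" using p \<beta>I[OF i(1)] by (auto simp: indexed_partition_def)
        then show ?thesis using False by blast
      qed
      then show "\<exists>y. (x \<in> g ` X \<longrightarrow> y = \<phi> x) \<and> (\<forall>i\<in>I. x \<in> P i \<longrightarrow> y \<in> P (\<beta> i))"
        using block_unique[OF p i(1) _ i(2)] by blast
    qed
    from bchoice[OF this] obtain q where
      ext: "\<forall>x\<in>X. (x \<in> g ` X \<longrightarrow> q x = \<phi> x) \<and> (\<forall>i\<in>I. x \<in> P i \<longrightarrow> q x \<in> P (\<beta> i))" ..
    have q: "q x = \<phi> x" if "x \<in> X" "x \<in> g ` X" for x
      using ext that by blast
    have q\<beta>: "q x \<in> P (\<beta> i)" if "x \<in> X" "i \<in> I" "x \<in> P i" for x i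
      using ext that by blast
    let ?u = "restrict u X" and ?q = "restrict q X"
    have uM: "?u \<in> carrier ?M"
      using u block_subset[OF p] by (intro char_trans_memI[OF p S \<alpha>]) (auto simp: subset_iff)
    have qM: "?q \<in> carrier ?M"
      using q\<beta> block_subset[OF p] by (intro char_trans_memI[OF p S \<beta>]) (auto simp: subset_iff)
    let ?h = "?u \<otimes>\<^bsub>?M\<^esub> g \<otimes>\<^bsub>?M\<^esub> ?q"
    have hX: "?h \<in> X \<rightarrow>\<^sub>E X"
      by (intro char_trans_memD(2)[OF p, where S = S] M.m_closed uM g qM)
    have "f = ?h"
    proof (rule extensionalityI)
      show "f \<in> extensional X" "?h \<in> extensional X" using fX hX by (auto simp: PiE_def)
      fix x assume x: "x \<in> X"
      obtain i where i: "i \<in> I" "x \<in> P i" using mem_block[OF p x] .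
      have uX: "u x \<in> X" using char_trans_memD(2)[OF p uM] x by auto
      have gu: "g (u x) \<in> X" using gX uX by blast
      have "f x = \<phi> (g (u x))" using u[OF x i] by simp
      also have "\<dots> = ?q (g (?u x))" using q[OF gu] uX gu x by simp
      finally show "f x = ?h x"
        by (simp only: char_trans_mult_apply[OF char_trans_memD(2)[OF p uM] x])
    qed
    then show ?ideal unfolding M.mem_two_sided_ideal using uM qM by blast
  qed
qed

theorem theorem5p12:
  fixes X :: "'a set" and I :: "'i set" and P :: "'i \<Rightarrow> 'a set"
    and S :: "('i \<Rightarrow> 'i) set" and f g :: "'a \<Rightarrow> 'a"
  assumes "X \<noteq> {}"
    and "indexed_partition X I P"
    and "subsemigroup S (full_trans I)"
    and "\<one>\<^bsub>full_trans I\<^esub> \<in> S"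
    and "f \<in> carrier (char_trans X I P S)"
    and "g \<in> carrier (char_trans X I P S)"
  shows "(f, g) \<in> green_J (char_trans X I P S) \<longleftrightarrow>
    (\<exists>\<alpha>\<in>S. \<exists>\<beta>\<in>S. \<exists>\<gamma>\<in>S. \<exists>\<delta>\<in>S. \<exists>\<phi> \<in> g ` X \<rightarrow>\<^sub>E X. \<exists>\<psi> \<in> f ` X \<rightarrow>\<^sub>E X.
      (\<forall>i\<in>I. f ` P i \<subseteq> \<phi> ` (g ` P (\<alpha> i)) \<and> g ` P i \<subseteq> \<psi> ` (f ` P (\<gamma> i))) \<and>
      (\<forall>i \<in> character I P g ` I. \<phi> ` (P i \<inter> g ` X) \<subseteq> P (\<beta> i)) \<and>
      (\<forall>j \<in> character I P f ` I. \<psi> ` (P j \<inter> f ` X) \<subseteq> P (\<delta> j)))"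
proof -
  interpret M: monoid "char_trans X I P S" by (rule monoid_char_trans[OF assms(2-4)])
  \<comment> \<open>The conditions on \<open>\<alpha>, \<beta>, \<phi>\<close> and those on \<open>\<gamma>, \<delta>, \<psi>\<close> share no witness, so the two
    solvability statements may be merged under one quantifier prefix.\<close>
  have regroup: "(\<exists>\<alpha>\<in>A. \<exists>\<beta>\<in>A. \<exists>\<phi>\<in>B. Q \<alpha> \<phi> \<and> Q' \<beta> \<phi>) \<and>
        (\<exists>\<gamma>\<in>A. \<exists>\<delta>\<in>A. \<exists>\<psi>\<in>C. R \<gamma> \<psi> \<and> R' \<delta> \<psi>) \<longleftrightarrow>
      (\<exists>\<alpha>\<in>A. \<exists>\<beta>\<in>A. \<exists>\<gamma>\<in>A. \<exists>\<delta>\<in>A. \<exists>\<phi>\<in>B. \<exists>\<psi>\<in>C.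
        (Q \<alpha> \<phi> \<and> R \<gamma> \<psi>) \<and> Q' \<beta> \<phi> \<and> R' \<delta> \<psi>)"
    for A :: "'c set" and B C :: "'d set" and Q Q' R R' :: "'c \<Rightarrow> 'd \<Rightarrow> bool"
    by (rule iffI; elim bexE conjE; intro bexI conjI; assumption)
  show ?thesis
    unfolding M.green_J_iff_mutual_ideals[OF assms(5,6)]
      principal_ideal_iff[OF assms(2-6)] principal_ideal_iff[OF assms(2-4,6,5)]
      ball_conj_distrib
    by (rule regroup)
qed

end
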